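(* The group $\mathcal{E}$ contains no distortion elements.
   Context: Identify $\mathbb{T}^1=\mathbb{R}/\mathbb{Z}$ with $[0,1)$. An interval exchange transformation is a bijection $f:\mathbb{T}^1\to\mathbb{T}^1$ for which there is a partition of $[0,1)$ into finitely many half-open intervals $[a,b)$ on each of which $f$ is a translation $x\mapsto x+c \pmod 1$. $\mathcal{E}$ is the group of all interval exchange transformations under composition. For a finitely generated group $G$ with finite generating set $S$, an element $f\in G$ is a distortion element if $f$ has infinite order and $\liminf_{n\to\infty}|f^n|_S/n=0$, where $|\cdot|_S$ is word length with respect to $S\cup S^{-1}$. For an arbitrary group $G$, $f\in G$ is a distortion element in $G$ if it is a distortion element in some finitely generated subgroup of $G$. *)

theory Defs
  imports "HOL-Analysis.Analysis" "HOL-Library.Liminf_Limsup"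
begin

text \<open>The circle T^1 = R/Z is identified with [0,1); maps are real functions
  that act on [0,1) and are the identity outside [0,1), so that composition of
  such maps is composition in the group.\<close>

definition is_iet :: "(real \<Rightarrow> real) \<Rightarrow> bool" where
  "is_iet f \<longleftrightarrow>
     bij_betw f {0..<1} {0..<1} \<and>
     (\<forall>x. x \<notin> {0..<1} \<longrightarrow> f x = x) \<and>
     (\<exists>a :: nat \<Rightarrow> real. \<exists>k. a 0 = 0 \<and> a k = 1 \<and>
        (\<forall>i<k. a i < a (Suc i)) \<and>
        (\<forall>i<k. \<exists>c. \<forall>x \<in> {a i..<a (Suc i)}. f x = frac (x + c)))"

definition IET :: "(real \<Rightarrow> real) set" where
  "IET = {f. is_iet f}"

definition iet_inv :: "(real \<Rightarrow> real) \<Rightarrow> real \<Rightarrow> real" where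
  "iet_inv f = (\<lambda>x. if x \<in> {0..<1} then inv_into {0..<1} f x else x)"

definition sym_gens :: "(real \<Rightarrow> real) set \<Rightarrow> (real \<Rightarrow> real) set" where
  "sym_gens S = S \<union> iet_inv ` S"

definition eval_word :: "(real \<Rightarrow> real) list \<Rightarrow> real \<Rightarrow> real" where
  "eval_word ws = foldr (\<circ>) ws id"

definition words_for :: "(real \<Rightarrow> real) set \<Rightarrow> (real \<Rightarrow> real) \<Rightarrow> (real \<Rightarrow> real) list set" where
  "words_for S g = {ws. set ws \<subseteq> sym_gens S \<and> eval_word ws = g}"

definition gen_subgroup :: "(real \<Rightarrow> real) set \<Rightarrow> (real \<Rightarrow> real) set" where
  "gen_subgroup S = {g. words_for S g \<noteq> {}}"

definition word_length :: "(real \<Rightarrow> real) set \<Rightarrow> (real \<Rightarrow> real) \<Rightarrow> nat" where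
  "word_length S g = (LEAST n. \<exists>ws \<in> words_for S g. length ws = n)"

definition infinite_order :: "(real \<Rightarrow> real) \<Rightarrow> bool" where
  "infinite_order f \<longleftrightarrow> (\<forall>n::nat. n > 0 \<longrightarrow> f ^^ n \<noteq> id)"

definition distortion_fg :: "(real \<Rightarrow> real) set \<Rightarrow> (real \<Rightarrow> real) \<Rightarrow> bool" where
  "distortion_fg S f \<longleftrightarrow>
     f \<in> gen_subgroup S \<and> infinite_order f \<and>
     liminf (\<lambda>n::nat. ereal (real (word_length S (f ^^ n)) / real n)) = 0"

definition distortion_in_IET :: "(real \<Rightarrow> real) \<Rightarrow> bool" where
  "distortion_in_IET f \<longleftrightarrow>
     (\<exists>S. finite S \<and> S \<subseteq> IET \<and> distortion_fg S f)"

end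

theory Submission
  imports Defs "HOL-Combinatorics.Cycles"
begin

text \<open>
  Extended by the identity to the real line, an interval exchange \<open>f\<close> is a piecewise translation
  with values \<open>f\<close> from the right and \<open>left_lim f\<close> from the left. The word length of \<open>f ^^ n\<close> bounds,
  up to a constant, both the number of its breaks and every additive functional of its
  displacements \<open>(f ^^ n) x - x\<close>. These displacements lie in a finitely generated group, on which
  finitely many functionals are proper.

  If \<open>f ^^ n\<close> has sublinearly many breaks along some sequence, then at every break with no earlier
  break on its orbit the left and right orbits merge again. Consequently, away from a finite set
  \<open>W\<close>, the maps \<open>f ^^ n\<close> have boundedly many breaks with jumps from a finite set, so the
  displacement of \<open>f ^^ n\<close> varies within a finite set on each component of the complement of \<open>W\<close>,
  uniformly in \<open>n\<close>. If \<open>x\<close> and \<open>(f ^^ m) x\<close> lie in the same component, the displacements of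
  \<open>f ^^ m\<close> along the orbit of \<open>x\<close> agree up to a bounded error, and sublinear growth bounds every
  functional of \<open>(f ^^ m) x - x\<close>, leaving finitely many values. All orbits then have bounded size
  and \<open>f\<close> has finite order.
\<close>

section \<open>Piecewise translations of the real line\<close>

definition displacement :: "('a::ab_group_add \<Rightarrow> 'a) \<Rightarrow> 'a \<Rightarrow> 'a" where
  "displacement f x = f x - x"

lemma displacement_eq_iff: "displacement f x = d \<longleftrightarrow> f x = x + d"
  by (auto simp: displacement_def)

lemma displacement_id [simp]: "displacement id x = 0"
  by (simp add: displacement_def)

lemma displacement_comp: "displacement (f \<circ> g) x = displacement g x + displacement f (g x)"
  by (simp add: displacement_def)

lemma displacement_inv:
  assumes "surj f"
  shows "displacement (inv f) x = - displacement f (inv f x)"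
  using assms by (simp add: displacement_def surj_f_inv_f)

definition translates :: "('a::ab_group_add \<Rightarrow> 'a) \<Rightarrow> 'a \<Rightarrow> 'a filter \<Rightarrow> bool" where
  "translates f d F \<longleftrightarrow> (\<forall>\<^sub>F x in F. f x = x + d)"

lemma translates_comp:
  assumes "translates g d F" "translates f c (filtermap (\<lambda>x. x + d) F)"
  shows "translates (f \<circ> g) (d + c) F"
  using assms unfolding translates_def eventually_filtermap
  by eventually_elim (simp add: add.assoc)

lemma translates_inv:
  assumes "inj f" "translates f d F"
  shows "translates (inv f) (- d) (filtermap (\<lambda>x. x + d) F)"
  using assms(2) unfolding translates_def eventually_filtermap
proof eventually_elim
  case (elim x)
  then show ?case using inv_f_eq[OF assms(1) elim] by simp
qed

lemma filtermap_at_left_add: "filtermap (\<lambda>x. x + d) (at_left a) = at_left (a + d)"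
  for a d :: real
  using filtermap_at_left_shift[of "- d" a] by simp

lemma filtermap_at_right_add: "filtermap (\<lambda>x. x + d) (at_right a) = at_right (a + d)"
  for a d :: real
  using filtermap_at_right_shift[of "- d" a] by simp

definition breaks :: "(real \<Rightarrow> real) \<Rightarrow> real set" where
  "breaks f = {x. \<not> translates f (displacement f x) (at_left x)}"

definition piecewise_translation :: "(real \<Rightarrow> real) \<Rightarrow> bool" where
  "piecewise_translation f \<longleftrightarrow>
     bij f \<and> (\<forall>x. translates f (displacement f x) (at_right x)) \<and> finite (breaks f)"

lemma piecewise_translationD:
  assumes "piecewise_translation f"
  shows "bij f" "translates f (displacement f x) (at_right x)" "finite (breaks f)"
  using assms by (auto simp: piecewise_translation_def)

lemma breaks_id [simp]: "breaks id = {}"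
  by (simp add: breaks_def translates_def)

lemma piecewise_translation_id: "piecewise_translation id"
  by (simp add: piecewise_translation_def translates_def)

lemma breaks_comp_subset: "breaks (f \<circ> g) \<subseteq> breaks g \<union> g -` breaks f"
proof
  fix x assume x: "x \<in> breaks (f \<circ> g)"
  show "x \<in> breaks g \<union> g -` breaks f"
  proof (rule ccontr)
    assume "x \<notin> breaks g \<union> g -` breaks f"
    then have "translates g (displacement g x) (at_left x)"
      "translates f (displacement f (g x)) (at_left (g x))"
      by (auto simp: breaks_def)
    then have "translates (f \<circ> g) (displacement (f \<circ> g) x) (at_left x)"
      unfolding displacement_comp
      by (intro translates_comp) (simp_all add: filtermap_at_left_add displacement_def)
    with x show False by (simp add: breaks_def)
  qed
qed

lemma piecewise_translation_comp:
  assumes f: "piecewise_translation f" and g: "piecewise_translation g"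
  shows "piecewise_translation (f \<circ> g)"
  unfolding piecewise_translation_def
proof (intro conjI allI)
  note f = piecewise_translationD[OF f] and g = piecewise_translationD[OF g]
  show "bij (f \<circ> g)" using g(1) f(1) by (rule bij_comp)
  have "finite (g -` breaks f)" using f(3) g(1) by (intro finite_vimageI) (auto simp: bij_is_inj)
  then show "finite (breaks (f \<circ> g))"
    using breaks_comp_subset[of f g] g(3) finite_subset by blast
  show "translates (f \<circ> g) (displacement (f \<circ> g) x) (at_right x)" for x
    unfolding displacement_comp using g(2)[of x] f(2)[of "g x"]
    by (intro translates_comp) (simp_all add: filtermap_at_right_add displacement_def)
qed

lemma card_breaks_comp:
  assumes f: "piecewise_translation f" and g: "piecewise_translation g"
  shows "card (breaks (f \<circ> g)) \<le> card (breaks f) + card (breaks g)"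
proof -
  have fin: "finite (breaks f)" "finite (breaks g)" and inj: "inj g"
    using f g by (auto simp: piecewise_translation_def bij_is_inj)
  have "card (breaks (f \<circ> g)) \<le> card (breaks g \<union> g -` breaks f)"
    using fin inj by (intro card_mono breaks_comp_subset) (auto intro: finite_vimageI)
  also have "\<dots> \<le> card (breaks g) + card (g -` breaks f)" by (rule card_Un_le)
  also have "card (g -` breaks f) \<le> card (breaks f)"
    using fin inj by (intro card_inj_on_le[of g]) (auto intro: inj_on_subset)
  finally show ?thesis by simp
qed

lemma piecewise_translation_funpow:
  assumes "piecewise_translation f"
  shows "piecewise_translation (f ^^ n)"
  by (induction n)
    (simp_all only: funpow.simps piecewise_translation_id assms piecewise_translation_comp)

lemma breaks_inv_subset:
  assumes "bij f"
  shows "breaks (inv f) \<subseteq> f ` breaks f"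
proof
  fix z assume z: "z \<in> breaks (inv f)"
  have f_inv: "f (inv f z) = z" using assms by (simp add: bij_is_surj surj_f_inv_f)
  have "inv f z \<in> breaks f"
  proof (rule ccontr)
    assume "inv f z \<notin> breaks f"
    then have "translates f (displacement f (inv f z)) (at_left (inv f z))"
      by (simp add: breaks_def)
    from translates_inv[OF bij_is_inj[OF assms] this] z show False
      using assms f_inv
      by (simp add: breaks_def filtermap_at_left_add displacement_inv bij_is_surj)
        (simp add: displacement_def)
  qed
  then show "z \<in> f ` breaks f" using f_inv by (metis imageI)
qed

lemma piecewise_translation_inv:
  assumes "piecewise_translation f"
  shows "piecewise_translation (inv f)"
  unfolding piecewise_translation_def
proof (intro conjI allI)
  note f = piecewise_translationD[OF assms]
  show "bij (inv f)" using f(1) by (rule bij_imp_bij_inv)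
  show "finite (breaks (inv f))"
    using breaks_inv_subset[OF f(1)] f(3) finite_subset by blast
  fix z
  have f_inv: "f (inv f z) = z" using f(1) by (simp add: bij_is_surj surj_f_inv_f)
  from translates_inv[OF bij_is_inj[OF f(1)] f(2)[of "inv f z"]]
  show "translates (inv f) (displacement (inv f) z) (at_right z)"
    using f(1) f_inv
    by (simp add: filtermap_at_right_add displacement_inv bij_is_surj) (simp add: displacement_def)
qed

section \<open>Left limits and jumps\<close>

definition left_lim :: "(real \<Rightarrow> real) \<Rightarrow> real \<Rightarrow> real" where
  "left_lim f x = Lim (at_left x) f"

lemma left_lim_eq:
  assumes "translates f d (at_left x)"
  shows "left_lim f x = x + d"
proof -
  have "((\<lambda>y. y + d) \<longlongrightarrow> x + d) (at_left x)" by (intro tendsto_intros)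
  moreover have "\<forall>\<^sub>F y in at_left x. y + d = f y"
    using assms unfolding translates_def by eventually_elim simp
  ultimately have "(f \<longlongrightarrow> x + d) (at_left x)" by (rule Lim_transform_eventually)
  then show ?thesis unfolding left_lim_def by (intro tendsto_Lim) simp
qed

lemma eventually_at_left_Int_atMost:
  fixes x :: "'a::linorder_topology"
  assumes "finite F"
  shows "\<forall>\<^sub>F y in at_left x. F \<inter> {..y} = F \<inter> {..<x}"
proof -
  have "\<forall>\<^sub>F y in at_left x. \<forall>z\<in>F. z < x \<longrightarrow> z < y"
    using assms order_tendstoD(1)[OF tendsto_ident_at]
    by (intro eventually_ball_finite ballI) (auto simp: eventually_conj_iff)
  moreover have "\<forall>\<^sub>F y in at_left x. y < x" by (simp add: eventually_at_filter)
  ultimately show ?thesis by eventually_elim auto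
qed

lemma eventually_at_right_Int_atMost:
  fixes x :: "'a::linorder_topology"
  assumes "finite F"
  shows "\<forall>\<^sub>F y in at_right x. F \<inter> {..y} = F \<inter> {..x}"
proof -
  have "\<forall>\<^sub>F y in at_right x. \<forall>z\<in>F. x < z \<longrightarrow> y < z"
    using assms order_tendstoD(2)[OF tendsto_ident_at]
    by (intro eventually_ball_finite ballI) (auto simp: eventually_conj_iff)
  moreover have "\<forall>\<^sub>F y in at_right x. x < y" by (simp add: eventually_at_filter)
  ultimately show ?thesis by eventually_elim force
qed

lemma eventually_constant_imp_constant_on:
  assumes "open S" "connected S" "\<And>a. a \<in> S \<Longrightarrow> \<forall>\<^sub>F x in at a. h x = h a"
  shows "h constant_on S"
proof (rule locally_constant_imp_constant)
  fix a assume a: "a \<in> S"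
  obtain T where T: "open T" "a \<in> T" "\<forall>x\<in>T. x \<noteq> a \<longrightarrow> h x = h a"
    using assms(3)[OF a] by (auto simp: eventually_at_topological)
  show "\<exists>T. openin (top_of_set S) T \<and> a \<in> T \<and> (\<forall>x\<in>T. h x = h a)"
    using T a by (intro exI[of _ "S \<inter> T"]) (auto simp: openin_open_Int)
qed fact

lemma ex_translates_at_left:
  assumes "piecewise_translation f"
  shows "\<exists>d. translates f d (at_left x)"
proof -
  note f = piecewise_translationD[OF assms]
  have "\<forall>\<^sub>F a in at_left x. breaks f \<inter> {..a} = breaks f \<inter> {..<x} \<and> a < x"
    by (intro eventually_conj eventually_at_left_Int_atMost f) (simp add: eventually_at_filter)
  then obtain a where a: "a < x" "breaks f \<inter> {..a} = breaks f \<inter> {..<x}"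
    using eventually_happens'[OF trivial_limit_at_left_real] by blast
  have "displacement f constant_on {a<..<x}"
  proof (rule eventually_constant_imp_constant_on)
    fix z assume z: "z \<in> {a<..<x}"
    then have "z \<notin> breaks f" using a(2) by (auto simp: set_eq_iff dest!: spec[of _ z])
    then have "translates f (displacement f z) (at z)"
      using f(2)[of z] by (simp add: breaks_def translates_def eventually_at_split)
    then show "\<forall>\<^sub>F y in at z. displacement f y = displacement f z"
      unfolding translates_def by eventually_elim (simp add: displacement_def)
  qed simp_all
  then obtain d where "\<forall>y\<in>{a<..<x}. displacement f y = d" by (auto simp: constant_on_def)
  then have "translates f d (at_left x)"
    unfolding translates_def eventually_at_left[OF a(1)] using a(1)
    by (intro exI[of _ a]) (auto simp: displacement_eq_iff)
  then show ?thesis ..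
qed

lemma translates_left_lim:
  assumes "piecewise_translation f"
  shows "translates f (left_lim f x - x) (at_left x)"
  using ex_translates_at_left[OF assms, of x] left_lim_eq by fastforce

lemma breaks_iff_left_lim:
  assumes "piecewise_translation f"
  shows "x \<in> breaks f \<longleftrightarrow> left_lim f x \<noteq> f x"
  using translates_left_lim[OF assms, of x] left_lim_eq[of f "displacement f x" x]
  by (auto simp: breaks_def displacement_def)

lemma left_lim_comp:
  assumes f: "piecewise_translation f" and g: "piecewise_translation g"
  shows "left_lim (f \<circ> g) x = left_lim f (left_lim g x)"
proof -
  have "translates (f \<circ> g)
      ((left_lim g x - x) + (left_lim f (left_lim g x) - left_lim g x)) (at_left x)"
    using translates_left_lim[OF g, of x] translates_left_lim[OF f, of "left_lim g x"]
    by (intro translates_comp) (simp_all add: filtermap_at_left_add)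
  from left_lim_eq[OF this] show ?thesis by simp
qed

lemma left_lim_funpow:
  assumes "piecewise_translation f"
  shows "left_lim (f ^^ n) = left_lim f ^^ n"
proof (induction n)
  case 0
  show ?case using left_lim_eq[of id 0] by (simp add: translates_def fun_eq_iff id_def)
next
  case (Suc n)
  then show ?case
    using left_lim_comp[OF assms piecewise_translation_funpow[OF assms, of n]]
    by (simp add: fun_eq_iff comp_def)
qed

definition jump :: "(real \<Rightarrow> real) \<Rightarrow> real \<Rightarrow> real" where
  "jump f x = f x - left_lim f x"

lemma sum_jump_atMost:
  assumes "piecewise_translation f"
  shows "sum (jump f) (breaks f \<inter> {..x}) = sum (jump f) (breaks f \<inter> {..<x}) + jump f x"
proof (cases "x \<in> breaks f")
  case True
  then have "breaks f \<inter> {..x} = insert x (breaks f \<inter> {..<x})" by auto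
  then show ?thesis using piecewise_translationD(3)[OF assms] by simp
next
  case False
  then have "breaks f \<inter> {..x} = breaks f \<inter> {..<x}" by (auto simp: order_le_less)
  moreover have "jump f x = 0" using False breaks_iff_left_lim[OF assms] by (simp add: jump_def)
  ultimately show ?thesis by simp
qed

lemma displacement_diff_eq_sum_jumps:
  assumes "piecewise_translation f"
  shows "displacement f y - displacement f x =
    sum (jump f) (breaks f \<inter> {..y}) - sum (jump f) (breaks f \<inter> {..x})"
proof -
  note f = piecewise_translationD[OF assms]
  define h where "h x = displacement f x - sum (jump f) (breaks f \<inter> {..x})" for x
  have "h constant_on UNIV"
  proof (rule eventually_constant_imp_constant_on)
    fix x
    have left_lim: "left_lim f x = f x - jump f x" by (simp add: jump_def)
    have "\<forall>\<^sub>F y in at_right x. h y = h x"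
      using f(2)[of x, unfolded translates_def] eventually_at_right_Int_atMost[OF f(3), of x]
      by eventually_elim (simp add: h_def displacement_def)
    moreover have "\<forall>\<^sub>F y in at_left x. h y = h x"
      using translates_left_lim[OF assms, of x, unfolded translates_def]
        eventually_at_left_Int_atMost[OF f(3), of x]
      by eventually_elim (simp add: h_def displacement_def left_lim sum_jump_atMost[OF assms])
    ultimately show "\<forall>\<^sub>F y in at x. h y = h x" by (simp add: eventually_at_split)
  qed simp_all
  then have "h y = h x" by (auto simp: constant_on_def)
  then show ?thesis by (simp add: h_def)
qed

lemma displacement_diff_eq_sum_jumps_outside:
  assumes f: "piecewise_translation f" and W: "W \<inter> {..x} = W \<inter> {..y}"
  shows "displacement f y - displacement f x =
    sum (jump f) ((breaks f - W) \<inter> {..y}) - sum (jump f) ((breaks f - W) \<inter> {..x})"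
proof -
  have "sum (jump f) (breaks f \<inter> {..z}) =
      sum (jump f) (breaks f \<inter> (W \<inter> {..z})) + sum (jump f) ((breaks f - W) \<inter> {..z})" for z
    using piecewise_translationD(3)[OF f]
    by (subst sum.union_disjoint[symmetric]) (auto intro!: sum.cong)
  then show ?thesis by (simp add: displacement_diff_eq_sum_jumps[OF f] W)
qed

lemma finite_range_displacement:
  assumes "piecewise_translation f"
  shows "finite (range (displacement f))"
proof -
  let ?g = "\<lambda>P. displacement f 0 + (sum (jump f) P - sum (jump f) (breaks f \<inter> {..0}))"
  have "range (displacement f) \<subseteq> ?g ` Pow (breaks f)"
  proof
    fix v assume "v \<in> range (displacement f)"
    then obtain y where "v = displacement f y" by blast
    then have "v = ?g (breaks f \<inter> {..y})"
      using displacement_diff_eq_sum_jumps[OF assms, of y 0] by simp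
    then show "v \<in> ?g ` Pow (breaks f)" by blast
  qed
  then show ?thesis using piecewise_translationD(3)[OF assms] finite_subset by blast
qed

section \<open>Additive functionals on finitely generated groups\<close>

interpretation rat_vector_space: vector_space "\<lambda>(q::rat) (x::'a::field_char_0). of_rat q * x"
  by unfold_locales (simp_all add: algebra_simps of_rat_add of_rat_mult)

definition rat_basis :: "'a::field_char_0 set" where
  "rat_basis = rat_vector_space.extend_basis {}"

definition rat_coord :: "'a::field_char_0 \<Rightarrow> 'a \<Rightarrow> rat" where
  "rat_coord = rat_vector_space.representation rat_basis"

lemma independent_rat_basis: "rat_vector_space.independent rat_basis"
  by (simp add: rat_basis_def rat_vector_space.independent_extend_basis
      rat_vector_space.independent_empty)

lemma span_rat_basis: "rat_vector_space.span rat_basis = UNIV"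
  by (simp add: rat_basis_def rat_vector_space.independent_empty)

lemma rat_coord_add: "rat_coord (x + y) b = rat_coord x b + rat_coord y b"
  by (simp add: rat_coord_def rat_vector_space.representation_add independent_rat_basis
      span_rat_basis)

lemma rat_coord_zero: "rat_coord 0 b = 0"
  using rat_coord_add[of 0 0 b] by simp

lemma finite_rat_coord_support: "finite {b. rat_coord x b \<noteq> 0}"
  by (simp add: rat_coord_def rat_vector_space.finite_representation)

lemma sum_rat_coord: "(\<Sum>b | rat_coord x b \<noteq> 0. of_rat (rat_coord x b) * b) = x"
  unfolding rat_coord_def
  by (rule rat_vector_space.sum_nonzero_representation_eq)
    (simp_all add: independent_rat_basis span_rat_basis)

lemma common_denominator:
  fixes Q :: "rat set"
  assumes "finite Q"
  obtains D :: int where "D > 0" "\<And>q. q \<in> Q \<Longrightarrow> of_int D * q \<in> \<int>"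
proof
  let ?d = "\<lambda>q. snd (quotient_of q)"
  show "(\<Prod>q\<in>Q. ?d q) > 0" by (intro prod_pos) (simp add: quotient_of_denom_pos')
  fix q assume "q \<in> Q"
  then obtain k where k: "(\<Prod>q\<in>Q. ?d q) = ?d q * k" using assms by (meson dvd_def dvd_prodI)
  have "of_int (?d q) * q = of_int (fst (quotient_of q))"
    using quotient_of_div[of q "fst (quotient_of q)" "?d q"] quotient_of_denom_pos'[of q]
    by (simp add: field_simps)
  then have "of_int (\<Prod>q\<in>Q. ?d q) * q = of_int (k * fst (quotient_of q))"
    unfolding k by (simp add: algebra_simps)
  then show "of_int (\<Prod>q\<in>Q. ?d q) * q \<in> \<int>" by (simp only: Ints_of_int)
qed

lemma finite_rat_bounded_denominator:
  assumes "D > 0"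
  shows "finite {q::rat. of_int D * q \<in> \<int> \<and> \<bar>real_of_rat q\<bar> \<le> r}" (is "finite ?Q")
proof -
  let ?K = "\<lceil>of_int D * r\<rceil>"
  have "?Q \<subseteq> (\<lambda>k. of_int k / of_int D) ` {- ?K..?K}"
  proof
    fix q assume q: "q \<in> ?Q"
    then obtain k where k: "of_int D * q = of_int k" by (auto elim: Ints_cases)
    then have "real_of_int D * real_of_rat q = of_int k"
      by (metis of_rat_mult of_rat_of_int_eq)
    then have "\<bar>real_of_int k\<bar> = of_int D * \<bar>real_of_rat q\<bar>"
      using assms by (metis abs_mult abs_of_pos of_int_0_less_iff)
    also have "\<dots> \<le> of_int D * r" using q assms by (intro mult_left_mono) auto
    finally have "k \<in> {- ?K..?K}" by (simp add: abs_le_iff) linarith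
    moreover have "q = of_int k / of_int D" using k assms by (simp add: field_simps)
    ultimately show "q \<in> (\<lambda>k. of_int k / of_int D) ` {- ?K..?K}" by blast
  qed
  then show ?thesis using finite_subset by blast
qed

definition rat_lattice :: "'a::field_char_0 set \<Rightarrow> int \<Rightarrow> 'a set" where
  "rat_lattice B D =
    {v. (\<forall>b\<in>B. of_int D * rat_coord v b \<in> \<int>) \<and> (\<forall>b. b \<notin> B \<longrightarrow> rat_coord v b = 0)}"

lemma sum_list_in_rat_lattice:
  assumes "T \<subseteq> rat_lattice B D" "xs \<in> lists T"
  shows "sum_list xs \<in> rat_lattice B D"
  using assms(2,1)
  by (induction xs) (auto simp: rat_lattice_def rat_coord_zero rat_coord_add distrib_left)

lemma finite_subset_rat_lattice:
  fixes T :: "'a::field_char_0 set"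
  assumes "finite T"
  obtains B D where "finite B" "D > 0" "T \<subseteq> rat_lattice B D"
proof -
  define B where "B = (\<Union>t\<in>T. {b. rat_coord t b \<noteq> 0})"
  have B: "finite B" using assms by (auto simp: B_def finite_rat_coord_support)
  have "finite (\<Union>t\<in>T. rat_coord t ` B)" using assms B by simp
  then obtain D :: int where D: "D > 0"
    and denom: "\<And>q. q \<in> (\<Union>t\<in>T. rat_coord t ` B) \<Longrightarrow> of_int D * q \<in> \<int>"
    using common_denominator by blast
  have "of_int D * rat_coord t b \<in> \<int>" if "t \<in> T" "b \<in> B" for t b
    using that by (intro denom) auto
  moreover have "rat_coord t b = 0" if "t \<in> T" "b \<notin> B" for t b
    using that by (auto simp: B_def)
  ultimately have "T \<subseteq> rat_lattice B D" by (auto simp: rat_lattice_def)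
  with B D show ?thesis by (rule that)
qed

lemma finite_bounded_rat_lattice:
  fixes B :: "'a::field_char_0 set"
  assumes B: "finite B" and "D > 0"
  shows "finite {v \<in> rat_lattice B D. \<forall>b\<in>B. \<bar>real_of_rat (rat_coord v b)\<bar> \<le> r}" (is "finite ?X")
proof -
  let ?F = "{q::rat. of_int D * q \<in> \<int> \<and> \<bar>real_of_rat q\<bar> \<le> r}"
  let ?v = "\<lambda>c. \<Sum>b\<in>B. of_rat (c b) * b :: 'a"
  have "?X \<subseteq> ?v ` Pi\<^sub>E B (\<lambda>_. ?F)"
  proof
    fix v assume v: "v \<in> ?X"
    have "v = ?v (rat_coord v)"
      using v B
      by (subst sum_rat_coord[of v, symmetric], intro sum.mono_neutral_left)
        (auto simp: rat_lattice_def)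
    then have "v = ?v (restrict (rat_coord v) B)" by simp
    then show "v \<in> ?v ` Pi\<^sub>E B (\<lambda>_. ?F)"
      by (rule image_eqI[where x = "restrict (rat_coord v) B"])
        (use v in \<open>auto simp: rat_lattice_def\<close>)
  qed
  moreover have "finite ?F" using \<open>D > 0\<close> by (rule finite_rat_bounded_denominator)
  ultimately show ?thesis by (rule finite_subset[OF _ finite_imageI[OF finite_PiE[OF B]]])
qed

lemma additive_rat_coord: "Modules.additive (\<lambda>x. of_rat (rat_coord x b))"
  by unfold_locales (simp add: rat_coord_add of_rat_add)

lemma finite_proper_additive_functionals:
  fixes T :: "'a::field_char_0 set"
  assumes "finite T"
  obtains H :: "('a \<Rightarrow> real) set" where "finite H" "\<And>h. h \<in> H \<Longrightarrow> Modules.additive h"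
    "\<And>r. finite {v \<in> sum_list ` lists T. \<forall>h\<in>H. \<bar>h v\<bar> \<le> r}"
proof -
  obtain B D where B: "finite B" and "D > 0" and T: "T \<subseteq> rat_lattice B D"
    using finite_subset_rat_lattice[OF assms] by blast
  let ?H = "(\<lambda>b x. real_of_rat (rat_coord x b)) ` B"
  show thesis
  proof
    show "finite ?H" using B by simp
    show "Modules.additive h" if "h \<in> ?H" for h using that additive_rat_coord by blast
    show "finite {v \<in> sum_list ` lists T. \<forall>h\<in>?H. \<bar>h v\<bar> \<le> r}" for r
      using finite_bounded_rat_lattice[OF B \<open>D > 0\<close>, of r]
      by (rule rev_finite_subset) (use sum_list_in_rat_lattice[OF T] in auto)
  qed
qed

lemma abs_additive_sum_list_le:
  fixes h :: "'a::ab_group_add \<Rightarrow> real"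
  assumes "Modules.additive h" "\<And>x. x \<in> set xs \<Longrightarrow> \<bar>h x\<bar> \<le> A"
  shows "\<bar>h (sum_list xs)\<bar> \<le> A * length xs"
  using assms(2)
proof (induction xs)
  case Nil
  show ?case using additive.zero[OF assms(1)] by simp
next
  case (Cons x xs)
  have "\<bar>h (sum_list (x # xs))\<bar> \<le> \<bar>h x\<bar> + \<bar>h (sum_list xs)\<bar>"
    by (simp add: additive.add[OF assms(1)])
  also have "\<dots> \<le> A + A * length xs" using Cons by (intro add_mono) auto
  finally show ?case by (simp add: algebra_simps)
qed

section \<open>Orbits of two maps that differ at finitely many points\<close>

lemma inj_funpow_if_not_periodic:
  assumes "inj f" "\<And>n. n > 0 \<Longrightarrow> (f ^^ n) x \<noteq> x"
  shows "inj (\<lambda>n. (f ^^ n) x)"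
proof (rule linorder_injI)
  fix m n :: nat
  assume "m < n"
  then show "(f ^^ m) x \<noteq> (f ^^ n) x"
    using funpow_diff[OF assms(1), of m n x] assms(2)[of "n - m"] by auto
qed

lemma finite_range_funpow_if_periodic:
  assumes "(f ^^ n) x = x" "n > 0"
  shows "finite (range (\<lambda>k. (f ^^ k) x))"
proof (rule finite_subset)
  show "range (\<lambda>k. (f ^^ k) x) \<subseteq> (\<lambda>k. (f ^^ k) x) ` {..<n}"
  proof
    fix y assume "y \<in> range (\<lambda>k. (f ^^ k) x)"
    then obtain k where "y = (f ^^ k) x" by blast
    then have "y = (f ^^ (k mod n)) x" using assms(1) by (simp add: funpow_mod_eq)
    then show "y \<in> (\<lambda>k. (f ^^ k) x) ` {..<n}" using assms(2) by auto
  qed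
qed simp

lemma inv_funpow_funpow:
  assumes "bij f"
  shows "(inv f ^^ j) ((f ^^ i) x) = (if j \<le> i then (f ^^ (i - j)) x else (inv f ^^ (j - i)) x)"
proof -
  have cancel: "(inv f ^^ k) ((f ^^ k) y) = y" for k y
    using inv_fn_o_fn_is_id[OF assms, of k] by (simp add: fun_eq_iff)
  show ?thesis
  proof (cases "j \<le> i")
    case True
    then show ?thesis using cancel[of j "(f ^^ (i - j)) x"] funpow_add[of j "i - j" f] by simp
  next
    case False
    then show ?thesis using cancel[of i x] funpow_add[of "j - i" i "inv f"] by simp
  qed
qed

lemma funpow_inv_funpow:
  assumes "bij f"
  shows "(f ^^ j) ((inv f ^^ i) x) = (if j \<le> i then (inv f ^^ (i - j)) x else (f ^^ (j - i)) x)"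
  using inv_funpow_funpow[OF bij_imp_bij_inv[OF assms], of j i x]
  by (simp only: inv_inv_eq[OF assms])

definition disagreement :: "('a \<Rightarrow> 'b) \<Rightarrow> ('a \<Rightarrow> 'b) \<Rightarrow> 'a set" where
  "disagreement f g = {x. f x \<noteq> g x}"

locale finite_modification =
  fixes f g :: "'a \<Rightarrow> 'a"
  assumes bij: "bij f" and finite_disagreement: "finite (disagreement f g)"
begin

lemma inj_f: "inj f" and inj_inv: "inj (inv f)"
  by (rule bij_is_inj[OF bij], rule bij_is_inj[OF bij_imp_bij_inv[OF bij]])

definition initial_points :: "'a set" where
  "initial_points = {p \<in> disagreement f g. \<forall>j>0. (inv f ^^ j) p \<notin> disagreement f g}"

definition inner_points :: "'a set" where
  "inner_points =
    {x. (\<exists>i. (f ^^ i) x \<in> disagreement f g) \<and> (\<exists>j>0. (inv f ^^ j) x \<in> disagreement f g)}"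

definition split_times :: "'a \<Rightarrow> nat set" where
  "split_times p = {k. (f ^^ k) p \<noteq> (g ^^ k) p}"

lemma funpow_agree:
  assumes "\<And>i. i < n \<Longrightarrow> (f ^^ i) x \<notin> disagreement f g"
  shows "(g ^^ n) x = (f ^^ n) x"
  using assms
proof (induction n)
  case (Suc n)
  then have "(g ^^ n) x = (f ^^ n) x" "(f ^^ n) x \<notin> disagreement f g" by simp_all
  then show ?case by (simp add: disagreement_def)
qed simp

lemma finite_disagreement_funpow: "finite (disagreement (f ^^ n) (g ^^ n))"
proof (rule finite_subset)
  show "disagreement (f ^^ n) (g ^^ n) \<subseteq> (\<Union>i<n. (f ^^ i) -` disagreement f g)"
    using funpow_agree[of n] by (fastforce simp: disagreement_def)
  show "finite (\<Union>i<n. (f ^^ i) -` disagreement f g)"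
    using finite_disagreement inj_f by (auto intro!: finite_vimageI)
qed

definition orbit_segment :: "'a \<Rightarrow> 'a \<Rightarrow> 'a set" where
  "orbit_segment p q = {x. (\<exists>j. (f ^^ j) p = x) \<and> (\<exists>i. (f ^^ i) x = q)}"

lemma finite_orbit_segment: "finite (orbit_segment p q)"
proof (cases "\<exists>n>0. (f ^^ n) p = p")
  case True
  then have "finite (range (\<lambda>j. (f ^^ j) p))" using finite_range_funpow_if_periodic by metis
  then show ?thesis by (rule rev_finite_subset) (auto simp: orbit_segment_def)
next
  case False
  then have orbit: "inj (\<lambda>j. (f ^^ j) p)"
    using inj_funpow_if_not_periodic[OF inj_f] by blast
  show ?thesis
  proof (cases "\<exists>m. (f ^^ m) p = q")
    case True
    then obtain m where m: "(f ^^ m) p = q" by blast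
    have "j \<le> m" if "(f ^^ i) ((f ^^ j) p) = q" for i j
    proof -
      have "(f ^^ (i + j)) p = (f ^^ m) p" using that m by (simp add: funpow_add)
      then have "i + j = m" by (rule injD[OF orbit])
      then show ?thesis by simp
    qed
    then have "orbit_segment p q \<subseteq> (\<lambda>j. (f ^^ j) p) ` {..m}" by (auto simp: orbit_segment_def)
    then show ?thesis by (rule finite_subset) simp
  next
    case False
    then have "(f ^^ i) ((f ^^ j) p) \<noteq> q" for i j by (metis comp_apply funpow_add)
    then have "orbit_segment p q = {}" unfolding orbit_segment_def by blast
    then show ?thesis by simp
  qed
qed

lemma finite_inner_points: "finite inner_points"
proof (rule finite_subset)
  let ?D = "disagreement f g"
  show "inner_points \<subseteq> (\<Union>p\<in>?D. \<Union>q\<in>?D. orbit_segment p q)"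
  proof
    fix x assume "x \<in> inner_points"
    then obtain i j where "(f ^^ i) x \<in> ?D" "(inv f ^^ j) x \<in> ?D" by (auto simp: inner_points_def)
    moreover have "(f ^^ j) ((inv f ^^ j) x) = x" by (simp add: funpow_inv_funpow[OF bij])
    ultimately show "x \<in> (\<Union>p\<in>?D. \<Union>q\<in>?D. orbit_segment p q)"
      unfolding orbit_segment_def by blast
  qed
qed (intro finite_UN_I finite_disagreement finite_orbit_segment)

lemma inj_orbit_initial_point:
  assumes "p \<in> initial_points"
  shows "inj (\<lambda>n. (f ^^ n) p)" "inj (\<lambda>n. (inv f ^^ n) p)"
proof -
  have backward: "(inv f ^^ n) p \<noteq> p" if "n > 0" for n
  proof -
    have "(inv f ^^ n) p \<notin> disagreement f g" "p \<in> disagreement f g"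
      using assms that by (simp_all add: initial_points_def)
    then show ?thesis by metis
  qed
  then have "(f ^^ n) p \<noteq> p" if "n > 0" for n
    using that inv_funpow_funpow[OF bij, of n n p] by auto
  with backward show "inj (\<lambda>n. (f ^^ n) p)" "inj (\<lambda>n. (inv f ^^ n) p)"
    by (simp_all add: inj_funpow_if_not_periodic inj_f inj_inv)
qed

lemma eventually_split_if_infinite:
  assumes "p \<in> initial_points" "infinite (split_times p)"
  obtains K where "\<And>k. k \<ge> K \<Longrightarrow> k \<in> split_times p"
proof -
  have "finite ((\<lambda>k. (f ^^ k) p) -` disagreement f g)"
    using finite_disagreement inj_orbit_initial_point(1)[OF assms(1)] by (rule finite_vimageI)
  then obtain K where K: "\<And>k. k \<ge> K \<Longrightarrow> (f ^^ k) p \<notin> disagreement f g"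
    unfolding finite_nat_set_iff_bounded by (metis linorder_not_less vimageI)
  have "k \<in> split_times p" if "k \<ge> K" for k
  proof (rule ccontr)
    assume k: "k \<notin> split_times p"
    have "l \<notin> split_times p" if "l \<ge> k" for l
      using that
    proof (induction l rule: dec_induct)
      case (step l)
      then show ?case using K[of l] \<open>k \<ge> K\<close> by (auto simp: split_times_def disagreement_def)
    qed (rule k)
    then have "split_times p \<subseteq> {..<k}" by (metis lessThan_iff linorder_not_less subsetI)
    then show False using assms(2) finite_subset by blast
  qed
  then show ?thesis using that by blast
qed

lemma backward_orbit_in_disagreement:
  assumes p: "p \<in> initial_points" and k: "k \<in> split_times p"
  shows "(inv f ^^ j) p \<in> disagreement (f ^^ (k + j)) (g ^^ (k + j))"
proof -
  define x where "x = (inv f ^^ j) p"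
  have x: "(f ^^ i) x = (inv f ^^ (j - i)) p" if "i \<le> j" for i
    using that by (simp add: x_def funpow_inv_funpow[OF bij])
  have "(g ^^ j) x = (f ^^ j) x"
    using p x by (intro funpow_agree) (auto simp: initial_points_def)
  with x[of j] k show ?thesis
    by (simp add: disagreement_def split_times_def funpow_add flip: x_def)
qed

text \<open>If the orbits of an initial point under \<open>f\<close> and \<open>g\<close> never merge, then \<open>f ^^ n\<close> and \<open>g ^^ n\<close>
  disagree at all but boundedly many of its first \<open>n\<close> backward iterates.\<close>

lemma finite_split_times:
  assumes p: "p \<in> initial_points"
    and few: "\<And>K. \<exists>n. card (disagreement (f ^^ n) (g ^^ n)) + K \<le> n"
  shows "finite (split_times p)"
proof (rule ccontr)
  assume "infinite (split_times p)"
  then obtain K where K: "\<And>k. k \<ge> K \<Longrightarrow> k \<in> split_times p"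
    using eventually_split_if_infinite[OF p] by blast
  obtain n where n: "card (disagreement (f ^^ n) (g ^^ n)) + K \<le> n" using few by blast
  have "(\<lambda>j. (inv f ^^ j) p) ` {..n - K} \<subseteq> disagreement (f ^^ n) (g ^^ n)"
  proof (intro image_subsetI)
    fix j assume "j \<in> {..n - K}"
    then have "n - j \<in> split_times p" "n - j + j = n" using n by (auto intro: K)
    with backward_orbit_in_disagreement[OF p, of "n - j" j]
    show "(inv f ^^ j) p \<in> disagreement (f ^^ n) (g ^^ n)" by simp
  qed
  then have "card {..n - K} \<le> card (disagreement (f ^^ n) (g ^^ n))"
    using inj_orbit_initial_point(2)[OF p] finite_disagreement_funpow
    by (intro card_inj_on_le[of "\<lambda>j. (inv f ^^ j) p"]) (auto intro: inj_on_subset)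
  with n show False by simp
qed

lemma outer_disagreement_cases:
  assumes "x \<in> disagreement (f ^^ n) (g ^^ n) - inner_points"
  obtains p k where "p \<in> initial_points" "k \<in> split_times p" "x = (inv f ^^ (n - k)) p"
    "(f ^^ n) x = (f ^^ k) p" "(g ^^ n) x = (g ^^ k) p"
proof -
  let ?D = "disagreement f g"
  have "(g ^^ n) x \<noteq> (f ^^ n) x" using assms by (auto simp: disagreement_def)
  then have "\<exists>i<n. (f ^^ i) x \<in> ?D" using funpow_agree by blast
  then obtain i where i: "i < n" "(f ^^ i) x \<in> ?D" and first: "\<And>l. l < i \<Longrightarrow> (f ^^ l) x \<notin> ?D"
    using exists_least_iff[of "\<lambda>i. i < n \<and> (f ^^ i) x \<in> ?D"] by (metis less_trans)
  define p k where "p = (f ^^ i) x" and "k = n - i"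
  have "(inv f ^^ j) p \<notin> ?D" if "j > 0" for j
  proof (cases "j \<le> i")
    case True
    with that first[of "i - j"] show ?thesis by (simp add: p_def inv_funpow_funpow[OF bij])
  next
    case False
    have "(inv f ^^ l) x \<notin> ?D" if "l > 0" for l
      using that assms i(2) unfolding inner_points_def by blast
    with False show ?thesis by (simp add: p_def inv_funpow_funpow[OF bij])
  qed
  then have p: "p \<in> initial_points" using i by (simp add: initial_points_def p_def)
  have n: "n = k + i" using i by (simp add: k_def)
  have g: "(g ^^ n) x = (g ^^ k) p" and f: "(f ^^ n) x = (f ^^ k) p"
    using funpow_agree[OF first] by (simp_all add: n funpow_add p_def)
  have "k \<in> split_times p" using assms f g by (simp add: split_times_def disagreement_def)
  moreover have "x = (inv f ^^ (n - k)) p" by (simp add: n p_def inv_funpow_funpow[OF bij])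
  ultimately show ?thesis using that p f g by blast
qed

lemma bounded_outer_disagreement:
  assumes few: "\<And>K. \<exists>n. card (disagreement (f ^^ n) (g ^^ n)) + K \<le> n"
  obtains M :: nat and V :: "('a \<times> 'a) set" where "finite V"
    "\<And>n. card (disagreement (f ^^ n) (g ^^ n) - inner_points) \<le> M"
    "\<And>n x. x \<in> disagreement (f ^^ n) (g ^^ n) - inner_points \<Longrightarrow> ((f ^^ n) x, (g ^^ n) x) \<in> V"
proof -
  define G where "G = Sigma initial_points split_times"
  define V where "V = (\<lambda>(p, k). ((f ^^ k) p, (g ^^ k) p)) ` G"
  have "finite initial_points" using finite_disagreement by (simp add: initial_points_def)
  then have G: "finite G" unfolding G_def
    by (rule finite_SigmaI) (rule finite_split_times[OF _ few])
  have "card (disagreement (f ^^ n) (g ^^ n) - inner_points) \<le> card G" for n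
  proof (rule surj_card_le[OF G])
    show "disagreement (f ^^ n) (g ^^ n) - inner_points \<subseteq> (\<lambda>(p, k). (inv f ^^ (n - k)) p) ` G"
    proof
      fix x assume "x \<in> disagreement (f ^^ n) (g ^^ n) - inner_points"
      then obtain p k where "(p, k) \<in> G" "x = (inv f ^^ (n - k)) p"
        by (rule outer_disagreement_cases) (simp add: G_def)
      then show "x \<in> (\<lambda>(p, k). (inv f ^^ (n - k)) p) ` G" by force
    qed
  qed
  moreover have "((f ^^ n) x, (g ^^ n) x) \<in> V"
    if "x \<in> disagreement (f ^^ n) (g ^^ n) - inner_points" for n x
  proof -
    from that obtain p k where "(p, k) \<in> G" "(f ^^ n) x = (f ^^ k) p" "(g ^^ n) x = (g ^^ k) p"
      by (rule outer_disagreement_cases) (simp add: G_def)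
    then show ?thesis unfolding V_def by force
  qed
  moreover have "finite V" using G by (simp add: V_def)
  ultimately show ?thesis using that by blast
qed

end

lemma finite_modification_left_lim:
  assumes "piecewise_translation f"
  shows "finite_modification f (left_lim f)"
    and "disagreement (f ^^ n) (left_lim f ^^ n) = breaks (f ^^ n)"
proof -
  show eq: "disagreement (f ^^ n) (left_lim f ^^ n) = breaks (f ^^ n)" for n
    unfolding left_lim_funpow[OF assms, symmetric]
    by (auto simp: disagreement_def breaks_iff_left_lim[OF piecewise_translation_funpow[OF assms]])
  show "finite_modification f (left_lim f)"
    using eq[of 1] piecewise_translationD[OF assms] by unfold_locales simp_all
qed

lemma finite_bounded_sums:
  fixes V :: "'a::comm_monoid_add set"
  assumes "finite V"
  obtains S where "finite S"
    "\<And>(J::'b set) h. finite J \<Longrightarrow> card J \<le> M \<Longrightarrow> h ` J \<subseteq> V \<Longrightarrow> sum h J \<in> S"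
proof
  show "finite (sum_list ` {xs. set xs \<subseteq> V \<and> length xs \<le> M})"
    using assms by (intro finite_imageI finite_lists_length_le)
  fix J :: "'b set" and h
  assume J: "finite J" "card J \<le> M" "h ` J \<subseteq> V"
  obtain zs where zs: "set zs = J" "distinct zs" using finite_distinct_list[OF J(1)] by blast
  then have "length (map h zs) \<le> M" "set (map h zs) \<subseteq> V" "sum h J = sum_list (map h zs)"
    using J by (auto simp: distinct_card sum_list_distinct_conv_sum_set)
  then show "sum h J \<in> sum_list ` {xs. set xs \<subseteq> V \<and> length xs \<le> M}" by blast
qed

lemma bounded_jumps_outside_finite_set:
  assumes f: "piecewise_translation f"
    and few: "\<And>K. \<exists>n. card (breaks (f ^^ n)) + K \<le> n"
  obtains W V :: "real set" and M :: nat where "finite W" "finite V"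
    "\<And>n. card (breaks (f ^^ n) - W) \<le> M"
    "\<And>n z. z \<in> breaks (f ^^ n) - W \<Longrightarrow> jump (f ^^ n) z \<in> V"
proof -
  note disagreement_eq = finite_modification_left_lim(2)[OF f]
  interpret finite_modification f "left_lim f" by (rule finite_modification_left_lim(1)[OF f])
  obtain M :: nat and V where V: "finite V"
    and M: "\<And>n. card (breaks (f ^^ n) - inner_points) \<le> M"
    and orbits: "\<And>n z. z \<in> breaks (f ^^ n) - inner_points \<Longrightarrow>
      ((f ^^ n) z, (left_lim f ^^ n) z) \<in> V"
    by (rule bounded_outer_disagreement[unfolded disagreement_eq, OF few]) (rule that)
  show ?thesis
  proof (rule that[OF finite_inner_points _ M])
    show "finite ((\<lambda>(r, l). r - l) ` V)" using V by simp
    show "jump (f ^^ n) z \<in> (\<lambda>(r, l). r - l) ` V" if "z \<in> breaks (f ^^ n) - inner_points" for n z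
      using orbits[OF that] by (force simp: jump_def left_lim_funpow[OF f])
  qed
qed

lemma finite_displacement_variation:
  assumes f: "piecewise_translation f"
    and few: "\<And>K. \<exists>n. card (breaks (f ^^ n)) + K \<le> n"
  obtains W U where "finite W" "finite U"
    "\<And>n x y. W \<inter> {..x} = W \<inter> {..y} \<Longrightarrow>
      displacement (f ^^ n) y - displacement (f ^^ n) x \<in> U"
proof -
  obtain W V :: "real set" and M :: nat where W: "finite W" and V: "finite V"
    and M: "\<And>n. card (breaks (f ^^ n) - W) \<le> M"
    and jumps: "\<And>n z. z \<in> breaks (f ^^ n) - W \<Longrightarrow> jump (f ^^ n) z \<in> V"
    by (rule bounded_jumps_outside_finite_set[OF f few]) (rule that)
  obtain S where S: "finite S"
    and sums: "\<And>(J::real set) h. finite J \<Longrightarrow> card J \<le> M \<Longrightarrow> h ` J \<subseteq> V \<Longrightarrow> sum h J \<in> S"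
    by (rule finite_bounded_sums[OF V, where M = M]) blast
  have outer: "sum (jump (f ^^ n)) ((breaks (f ^^ n) - W) \<inter> {..z}) \<in> S" for n z
  proof (rule sums)
    have fin: "finite (breaks (f ^^ n))"
      by (rule piecewise_translationD(3)[OF piecewise_translation_funpow[OF f]])
    then show "finite ((breaks (f ^^ n) - W) \<inter> {..z})" by simp
    have "card ((breaks (f ^^ n) - W) \<inter> {..z}) \<le> card (breaks (f ^^ n) - W)"
      using fin by (intro card_mono) auto
    also have "\<dots> \<le> M" by (rule M)
    finally show "card ((breaks (f ^^ n) - W) \<inter> {..z}) \<le> M" .
    show "jump (f ^^ n) ` ((breaks (f ^^ n) - W) \<inter> {..z}) \<subseteq> V" using jumps by blast
  qed
  show ?thesis
  proof (rule that[OF W])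
    show "finite ((\<lambda>(u, v). u - v) ` (S \<times> S))" using S by simp
    fix n x y
    assume "W \<inter> {..x} = W \<inter> {..y}"
    with outer[of n x] outer[of n y]
    show "displacement (f ^^ n) y - displacement (f ^^ n) x \<in> (\<lambda>(u, v). u - v) ` (S \<times> S)"
      by (force simp: displacement_diff_eq_sum_jumps_outside[OF piecewise_translation_funpow[OF f]])
  qed
qed

section \<open>Interval exchange transformations\<close>

lemma is_iet_pieces:
  assumes "is_iet f"
  obtains A where "finite A"
    "\<And>x. x \<in> {0..<1} \<Longrightarrow> \<exists>a\<in>A. \<exists>b c. x \<in> {a..<b} \<and> (\<forall>y\<in>{a..<b}. f y = frac (y + c))"
proof -
  obtain a :: "nat \<Rightarrow> real" and k where a: "a 0 = 0" "a k = 1"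
    and pieces: "\<forall>i<k. \<exists>c. \<forall>y\<in>{a i..<a (Suc i)}. f y = frac (y + c)"
    using assms by (auto simp: is_iet_def)
  have "\<exists>i<k. x \<in> {a i..<a (Suc i)}" if x: "x \<in> {0..<1}" for x
  proof -
    have "\<exists>i. \<not> x < a i \<and> x < a (Suc i) \<and> i < k"
      using x a ex_least_nat_less[of "\<lambda>j. x < a j" k] by (auto simp: not_less)
    then show ?thesis by auto
  qed
  with pieces show ?thesis by (intro that[of "a ` {..<k}"]) (simp, blast)
qed

lemma frac_eq_add_if_in_unit_cell:
  fixes x y :: real
  assumes "x - frac x \<le> y" "y < x + (1 - frac x)"
  shows "frac y = frac x + (y - x)"
proof -
  have "\<lfloor>y\<rfloor> = \<lfloor>x\<rfloor>" using assms unfolding floor_eq_iff frac_def by linarith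
  then show ?thesis by (simp add: frac_def)
qed

lemma translates_at_right_if_piece:
  fixes f :: "real \<Rightarrow> real"
  assumes piece: "\<And>y. y \<in> {a..<b} \<Longrightarrow> f y = frac (y + c)" and x: "x \<in> {a..<b}"
  shows "translates f (displacement f x) (at_right x)"
proof -
  have "\<forall>\<^sub>F y in at_right x. y \<in> {x<..<b}" using x by (intro eventually_at_right_real) simp
  moreover have "\<forall>\<^sub>F y in at_right x. y \<in> {x<..<x + (1 - frac (x + c))}"
    using frac_lt_1[of "x + c"] by (intro eventually_at_right_real) simp
  ultimately show ?thesis
    unfolding translates_def
  proof eventually_elim
    case (elim y)
    then have "x - frac (x + c) \<le> y"
      using frac_ge_0[of "x + c"] unfolding greaterThanLessThan_iff by linarith
    then have "frac (y + c) = frac (x + c) + (y - x)"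
      using elim frac_eq_add_if_in_unit_cell[of "x + c" "y + c"] by simp
    then show ?case using elim x by (simp add: piece displacement_def)
  qed
qed

lemma translates_at_left_if_piece:
  fixes f :: "real \<Rightarrow> real"
  assumes piece: "\<And>y. y \<in> {a..<b} \<Longrightarrow> f y = frac (y + c)" and x: "x \<in> {a<..<b}" "f x \<noteq> 0"
  shows "translates f (displacement f x) (at_left x)"
proof -
  have "frac (x + c) > 0" using x by (simp add: piece order_less_le del: frac_gt_0_iff)
  then have "\<forall>\<^sub>F y in at_left x. y \<in> {x - frac (x + c)<..<x}"
    by (intro eventually_at_left_real) simp
  moreover have "\<forall>\<^sub>F y in at_left x. y \<in> {a<..<x}" using x by (intro eventually_at_left_real) simp
  ultimately show ?thesis
    unfolding translates_def
  proof eventually_elim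
    case (elim y)
    then have "y < x + (1 - frac (x + c))"
      using frac_lt_1[of "x + c"] unfolding greaterThanLessThan_iff by linarith
    then have "frac (y + c) = frac (x + c) + (y - x)"
      using elim frac_eq_add_if_in_unit_cell[of "x + c" "y + c"] by simp
    then show ?case using elim x by (simp add: piece displacement_def)
  qed
qed

lemma is_iet_imp_bij:
  assumes "is_iet f"
  shows "bij f"
proof -
  have "bij_betw f {0..<1} {0..<1}" using assms by (simp add: is_iet_def)
  moreover have "bij_betw f (- {0..<1}) (- {0..<1})"
    using assms by (subst bij_betw_cong[of _ _ id]) (auto simp: is_iet_def)
  ultimately have "bij_betw f ({0..<1} \<union> - {0..<1}) ({0..<1} \<union> - {0..<1})"
    by (rule bij_betw_combine) simp
  then show ?thesis by simp
qed

lemma is_iet_imp_translates_outside: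
  assumes "is_iet f" "\<forall>\<^sub>F y in F. y \<notin> {0..<1}" "x \<notin> {0..<1}"
  shows "translates f (displacement f x) F"
  using assms(2) unfolding translates_def
  by eventually_elim (use assms in \<open>auto simp: is_iet_def displacement_def\<close>)

lemma is_iet_imp_translates_at_right:
  assumes f: "is_iet f"
  shows "translates f (displacement f x) (at_right x)"
proof (cases "x \<in> {0..<1}")
  case True
  then obtain a b c where "x \<in> {a..<b}" "\<forall>y\<in>{a..<b}. f y = frac (y + c)"
    using is_iet_pieces[OF f] by metis
  then show ?thesis by (intro translates_at_right_if_piece) auto
next
  case False
  then have "\<forall>\<^sub>F y in at_right x. y \<notin> {0..<1}"
    unfolding eventually_at_right_field
    by (cases "x < 0") (auto intro: exI[of _ 0] exI[of _ "x + 1"])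
  then show ?thesis using f False by (intro is_iet_imp_translates_outside)
qed

lemma is_iet_imp_finite_breaks:
  assumes f: "is_iet f"
  shows "finite (breaks f)"
proof -
  obtain A where A: "finite A" and pieces: "\<And>x. x \<in> {0..<1} \<Longrightarrow>
      \<exists>a\<in>A. \<exists>b c. x \<in> {a..<b} \<and> (\<forall>y\<in>{a..<b}. f y = frac (y + c))"
    using is_iet_pieces[OF f] by metis
  have "translates f (displacement f x) (at_left x)" if x: "x \<notin> insert 1 A" "f x \<noteq> 0" for x
  proof (cases "x \<in> {0..<1}")
    case True
    then obtain a b c where "a \<in> A" "x \<in> {a..<b}" and piece: "\<forall>y\<in>{a..<b}. f y = frac (y + c)"
      using pieces by blast
    then have "x \<in> {a<..<b}" using x(1) by (cases "a = x") auto
    then show ?thesis using piece x(2) by (intro translates_at_left_if_piece) auto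
  next
    case False
    then have "\<forall>\<^sub>F y in at_left x. y \<notin> {0..<1}"
      unfolding eventually_at_left_field using x(1)
      by (cases "x < 0") (auto intro: exI[of _ "x - 1"] exI[of _ 1])
    then show ?thesis using f False by (intro is_iet_imp_translates_outside)
  qed
  then have "breaks f \<subseteq> insert 1 A \<union> f -` {0}" by (auto simp: breaks_def)
  moreover have "finite (f -` {0})"
    using is_iet_imp_bij[OF f] by (intro finite_vimageI) (simp_all add: bij_is_inj)
  ultimately show ?thesis using A finite_subset by blast
qed

lemma is_iet_imp_piecewise_translation: "is_iet f \<Longrightarrow> piecewise_translation f"
  by (simp add: piecewise_translation_def is_iet_imp_bij is_iet_imp_translates_at_right
      is_iet_imp_finite_breaks)

lemma iet_inv_eq_inv:
  assumes "is_iet f"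
  shows "iet_inv f = inv f"
proof
  fix x
  have "f (iet_inv f x) = x"
  proof (cases "x \<in> {0..<1}")
    case True
    then have "x \<in> f ` {0..<1}" using assms by (simp add: is_iet_def bij_betw_def)
    with True show ?thesis by (simp add: iet_inv_def f_inv_into_f del: atLeastLessThan_iff)
  next
    case False
    then show ?thesis using assms by (auto simp: iet_inv_def is_iet_def)
  qed
  then show "iet_inv f x = inv f x" using is_iet_imp_bij[OF assms] by (metis bij_inv_eq_iff)
qed

lemma piecewise_translation_sym_gens:
  assumes "S \<subseteq> IET" "s \<in> sym_gens S"
  shows "piecewise_translation s"
proof -
  have "piecewise_translation g \<and> piecewise_translation (iet_inv g)" if "g \<in> S" for g
    using that assms(1)
    by (auto simp: IET_def iet_inv_eq_inv is_iet_imp_piecewise_translation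
        piecewise_translation_inv)
  then show ?thesis using assms(2) by (auto simp: sym_gens_def)
qed

section \<open>Words in the generators\<close>

lemma eval_word_simps: "eval_word [] = id" "eval_word (s # ws) = s \<circ> eval_word ws"
  by (simp_all add: eval_word_def)

lemma eval_word_append: "eval_word (us @ vs) = eval_word us \<circ> eval_word vs"
  by (induction us) (simp_all add: eval_word_simps comp_assoc)

lemma gen_subgroup_funpow:
  assumes "f \<in> gen_subgroup S"
  shows "f ^^ n \<in> gen_subgroup S"
proof (induction n)
  case 0
  have "[] \<in> words_for S id" by (simp add: words_for_def eval_word_simps)
  then show ?case by (auto simp: gen_subgroup_def id_def)
next
  case (Suc n)
  then obtain us vs where "us \<in> words_for S f" "vs \<in> words_for S (f ^^ n)"
    using assms by (auto simp: gen_subgroup_def)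
  then have "us @ vs \<in> words_for S (f ^^ Suc n)"
    by (simp add: words_for_def eval_word_append)
  then show ?case unfolding gen_subgroup_def by blast
qed

lemma word_length_attained:
  assumes "g \<in> gen_subgroup S"
  obtains ws where "set ws \<subseteq> sym_gens S" "eval_word ws = g" "length ws = word_length S g"
proof -
  have "\<exists>n. \<exists>ws\<in>words_for S g. length ws = n" using assms by (auto simp: gen_subgroup_def)
  then have "\<exists>ws\<in>words_for S g. length ws = word_length S g"
    unfolding word_length_def by (rule LeastI_ex)
  then show ?thesis using that by (auto simp: words_for_def)
qed

lemma displacement_eval_word:
  assumes "\<And>s x. s \<in> set ws \<Longrightarrow> displacement s x \<in> T"
  shows "\<exists>xs\<in>lists T. length xs = length ws \<and> displacement (eval_word ws) x = sum_list xs"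
  using assms
proof (induction ws)
  case (Cons s ws)
  then obtain xs where "xs \<in> lists T" "length xs = length ws"
      "displacement (eval_word ws) x = sum_list xs"
    by auto
  then show ?case
    using Cons.prems[of s "eval_word ws x"]
    by (intro bexI[of _ "displacement s (eval_word ws x) # xs"])
      (simp_all add: eval_word_simps displacement_comp del: comp_apply)
qed (simp add: eval_word_simps)

lemma card_breaks_eval_word:
  assumes "\<And>s. s \<in> set ws \<Longrightarrow> piecewise_translation s \<and> card (breaks s) \<le> C"
  shows "piecewise_translation (eval_word ws) \<and> card (breaks (eval_word ws)) \<le> C * length ws"
  using assms
proof (induction ws)
  case Nil
  show ?case by (simp add: eval_word_simps piecewise_translation_id del: id_apply)
next
  case (Cons s ws)
  then have s: "piecewise_translation s" "card (breaks s) \<le> C"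
    and ws: "piecewise_translation (eval_word ws)" "card (breaks (eval_word ws)) \<le> C * length ws"
    by simp_all
  have "card (breaks (s \<circ> eval_word ws)) \<le> C + C * length ws"
    using card_breaks_comp[OF s(1) ws(1)] s(2) ws(2) by simp
  with piecewise_translation_comp[OF s(1) ws(1)] show ?case
    by (simp add: eval_word_simps del: comp_apply)
qed

lemma word_length_bounds:
  assumes S: "finite S" "S \<subseteq> IET"
  obtains C T where "finite T"
    "\<And>g. g \<in> gen_subgroup S \<Longrightarrow> card (breaks g) \<le> C * word_length S g"
    "\<And>g x. g \<in> gen_subgroup S \<Longrightarrow>
      \<exists>xs\<in>lists T. length xs = word_length S g \<and> displacement g x = sum_list xs"
proof
  let ?G = "sym_gens S" and ?C = "\<Sum>s\<in>sym_gens S. card (breaks s)"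
  let ?T = "\<Union>s\<in>sym_gens S. range (displacement s)"
  have fin: "finite ?G" using S(1) by (simp add: sym_gens_def)
  have G: "piecewise_translation s" "card (breaks s) \<le> ?C" if "s \<in> ?G" for s
    using that fin S(2) by (auto intro: piecewise_translation_sym_gens member_le_sum)
  show "finite ?T" using fin G(1) finite_range_displacement by blast
  fix g assume "g \<in> gen_subgroup S"
  then obtain ws where ws: "set ws \<subseteq> ?G" "eval_word ws = g" "length ws = word_length S g"
    by (rule word_length_attained)
  show "card (breaks g) \<le> ?C * word_length S g"
    using card_breaks_eval_word[of ws ?C] G ws by auto
  show "\<exists>xs\<in>lists ?T. length xs = word_length S g \<and> displacement g x = sum_list xs" for x
    using displacement_eval_word[of ws ?T x] ws by auto
qed

section \<open>Growth of displacements\<close>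

lemma displacement_funpow_swap:
  "displacement (f ^^ m) ((f ^^ n) x) - displacement (f ^^ m) x =
   displacement (f ^^ n) ((f ^^ m) x) - displacement (f ^^ n) x"
proof -
  have "(f ^^ m) ((f ^^ n) x) = (f ^^ n) ((f ^^ m) x)" by (metis add.commute comp_apply funpow_add)
  then show ?thesis by (simp add: displacement_def)
qed

lemma sum_displacement_funpow_swap:
  "(\<Sum>i<n. displacement (f ^^ m) ((f ^^ i) x)) = (\<Sum>j<m. displacement (f ^^ n) ((f ^^ j) x))"
proof (induction n)
  case 0
  show ?case by (simp add: displacement_def)
next
  case (Suc n)
  define u where "u j = (f ^^ (n + j)) x" for j
  have shift: "(f ^^ k) ((f ^^ l) x) = (f ^^ (k + l)) x" for k l by (simp add: funpow_add)
  have "(\<Sum>j<m. displacement (f ^^ Suc n) ((f ^^ j) x)) -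
      (\<Sum>j<m. displacement (f ^^ n) ((f ^^ j) x)) = (\<Sum>j<m. u (Suc j) - u j)"
    unfolding sum_subtractf[symmetric] displacement_def shift u_def by simp
  also have "\<dots> = u m - u 0" by (rule sum_lessThan_telescope)
  also have "\<dots> = displacement (f ^^ m) ((f ^^ n) x)"
    by (simp add: displacement_def shift u_def add.commute)
  finally show ?case using Suc by (simp add: algebra_simps del: funpow.simps)
qed

text \<open>Up to an error \<open>n * B\<close>, \<open>n\<close> times the displacement of \<open>f ^^ m\<close> at \<open>x\<close> is the sum of its
  displacements at \<open>n\<close> points of the orbit, which is also a sum of only \<open>m\<close> displacements of
  \<open>f ^^ n\<close>.\<close>

lemma abs_displacement_funpow_le_if_sublinear:
  fixes h :: "'a::ab_group_add \<Rightarrow> real"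
  assumes h: "Modules.additive h"
    and variation: "\<And>n. \<bar>h (displacement (f ^^ m) ((f ^^ n) x) - displacement (f ^^ m) x)\<bar> \<le> B"
    and sublinear: "\<And>\<epsilon>. \<epsilon> > 0 \<Longrightarrow> \<exists>n>0. \<forall>y. \<bar>h (displacement (f ^^ n) y)\<bar> \<le> \<epsilon> * real n"
  shows "\<bar>h (displacement (f ^^ m) x)\<bar> \<le> B"
proof (rule field_le_epsilon)
  fix e :: real
  assume "e > 0"
  then obtain n where n: "n > 0" "\<And>y. \<bar>h (displacement (f ^^ n) y)\<bar> \<le> e / (real m + 1) * n"
    using sublinear[of "e / (real m + 1)"] by auto
  let ?v = "h (displacement (f ^^ m) x)" and ?d = "\<lambda>i. displacement (f ^^ m) ((f ^^ i) x)"
  have "real n * ?v = (\<Sum>i<n. h (?d i)) - (\<Sum>i<n. h (?d i - displacement (f ^^ m) x))"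
    by (simp add: additive.diff[OF h] sum_subtractf)
  also have "(\<Sum>i<n. h (?d i)) = (\<Sum>j<m. h (displacement (f ^^ n) ((f ^^ j) x)))"
    by (simp add: sum_displacement_funpow_swap flip: additive.sum[OF h])
  finally have "real n * \<bar>?v\<bar> \<le> \<bar>\<Sum>j<m. h (displacement (f ^^ n) ((f ^^ j) x))\<bar> +
      \<bar>\<Sum>i<n. h (?d i - displacement (f ^^ m) x)\<bar>"
    by (metis abs_mult abs_of_nat abs_triangle_ineq4)
  also have "\<dots> \<le> (\<Sum>j<m. e / (real m + 1) * n) + (\<Sum>i<n. B)"
    by (intro add_mono order_trans[OF sum_abs] sum_mono n(2) variation)
  also have "\<dots> = real m / (real m + 1) * (e * n) + n * B" by simp
  also have "\<dots> \<le> 1 * (e * n) + n * B"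
    using \<open>e > 0\<close> by (intro add_right_mono mult_right_mono) auto
  also have "\<dots> = n * (B + e)" by (simp add: algebra_simps)
  finally show "\<bar>?v\<bar> \<le> B + e" using n(1) by simp
qed

lemma not_inj_on_if_finite_cell_differences:
  fixes x :: "nat \<Rightarrow> 'a::ab_group_add"
  assumes fin: "finite V" "finite (range cell)"
    and V: "\<And>i j. i \<le> j \<Longrightarrow> cell (x i) = cell (x j) \<Longrightarrow> x j - x i \<in> V"
  shows "\<not> inj_on x {..card V * card (range cell)}"
proof
  let ?I = "{..card V * card (range cell)}"
  assume inj: "inj_on x ?I"
  define first where "first c = (LEAST i. cell (x i) = c)" for c
  have first: "first (cell (x j)) \<le> j" "cell (x (first (cell (x j)))) = cell (x j)" for j
    unfolding first_def by (auto intro: Least_le LeastI)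
  have "x ` ?I \<subseteq> (\<lambda>(v, c). x (first c) + v) ` (V \<times> range cell)"
  proof
    fix y assume "y \<in> x ` ?I"
    then obtain j where j: "y = x j" by blast
    let ?c = "cell (x j)"
    have "x j - x (first ?c) \<in> V" using V first by blast
    moreover have "y = x (first ?c) + (x j - x (first ?c))" using j by simp
    ultimately show "y \<in> (\<lambda>(v, c). x (first c) + v) ` (V \<times> range cell)"
      by (intro image_eqI[of _ _ "(x j - x (first ?c), ?c)"]) auto
  qed
  then have "card (x ` ?I) \<le> card (V \<times> range cell)"
    using fin by (intro surj_card_le) auto
  then show False using card_image[OF inj] by (simp add: card_cartesian_product)
qed

lemma funpow_fact_eq_id_if_bounded_orbits:
  assumes "inj f" and L: "\<And>x. \<not> inj_on (\<lambda>m. (f ^^ m) x) {..L}"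
  shows "f ^^ fact L = id"
proof
  fix x
  obtain i j where "i < j" "j \<le> L" "(f ^^ i) x = (f ^^ j) x"
    using L[of x] unfolding inj_on_def by (metis atMost_iff linorder_neqE_nat)
  then have "(f ^^ (j - i)) x = x" "j - i dvd fact L"
    using funpow_diff[OF assms(1)] by (auto intro: dvd_fact)
  then show "(f ^^ fact L) x = id x" using funpow_mod_eq[of "j - i" f x "fact L"] by simp
qed

lemma ex_le_mult_if_liminf_ratio_zero:
  fixes l :: "nat \<Rightarrow> nat" and \<epsilon> :: real
  assumes "liminf (\<lambda>n. ereal (real (l n) / real n)) = 0" "\<epsilon> > 0"
  shows "\<exists>n\<ge>K. n > 0 \<and> real (l n) \<le> \<epsilon> * real n"
proof (rule ccontr)
  assume "\<not> ?thesis"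
  then have large: "\<epsilon> * real n < real (l n)" if "n \<ge> K" "n > 0" for n using that by force
  have "\<forall>\<^sub>F n in sequentially. ereal \<epsilon> \<le> ereal (real (l n) / real n)"
    using eventually_ge_at_top[of "Suc K"]
  proof eventually_elim
    case (elim n)
    then show ?case using large[of n] by (simp add: field_simps)
  qed
  then have "ereal \<epsilon> \<le> liminf (\<lambda>n. ereal (real (l n) / real n))" by (rule Liminf_bounded)
  with assms show False by simp
qed

locale sublinear_piecewise_translation =
  fixes f :: "real \<Rightarrow> real" and l :: "nat \<Rightarrow> nat" and C :: nat and T :: "real set"
  assumes piecewise_translation: "piecewise_translation f"
    and liminf_zero: "liminf (\<lambda>n. ereal (real (l n) / real n)) = 0"
    and card_breaks_le: "card (breaks (f ^^ n)) \<le> C * l n"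
    and finite_steps: "finite T"
    and displacement_eq_sum_list:
      "\<exists>xs\<in>lists T. length xs = l n \<and> displacement (f ^^ n) x = sum_list xs"
begin

lemma few_breaks: "\<exists>n. card (breaks (f ^^ n)) + K \<le> n"
proof -
  obtain n where n: "n \<ge> 2 * K" "real (l n) \<le> 1 / real (2 * C + 1) * real n"
    using ex_le_mult_if_liminf_ratio_zero[OF liminf_zero, of "1 / real (2 * C + 1)" "2 * K"] by auto
  then have "real ((2 * C + 1) * l n) \<le> real n" by (simp add: field_simps)
  then have "2 * (C * l n) \<le> n" unfolding of_nat_le_iff by simp
  with card_breaks_le[of n] n(1) have "card (breaks (f ^^ n)) + K \<le> n" by linarith
  then show ?thesis ..
qed

lemma additive_displacement_sublinear:
  fixes \<epsilon> :: real
  assumes h: "Modules.additive h" and "\<epsilon> > 0"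
  shows "\<exists>n>0. \<forall>x. \<bar>h (displacement (f ^^ n) x)\<bar> \<le> \<epsilon> * real n"
proof -
  define A where "A = (\<Sum>t\<in>T. \<bar>h t\<bar>)"
  have A: "\<bar>h t\<bar> \<le> A" if "t \<in> T" for t
    unfolding A_def using finite_steps that by (intro member_le_sum) auto
  have "A \<ge> 0" unfolding A_def by (intro sum_nonneg) simp
  then obtain n where n: "n > 0" "real (l n) \<le> \<epsilon> / (A + 1) * real n"
    using ex_le_mult_if_liminf_ratio_zero[OF liminf_zero, of "\<epsilon> / (A + 1)"] \<open>\<epsilon> > 0\<close> by auto
  have "\<bar>h (displacement (f ^^ n) x)\<bar> \<le> \<epsilon> * n" for x
  proof -
    obtain xs where xs: "set xs \<subseteq> T" "length xs = l n" "displacement (f ^^ n) x = sum_list xs"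
      using displacement_eq_sum_list[of n x] by auto
    have "\<bar>h (displacement (f ^^ n) x)\<bar> \<le> A * l n"
      using abs_additive_sum_list_le[OF h, of xs A] A xs by auto
    also have "\<dots> \<le> (A + 1) * l n" by (intro mult_right_mono) auto
    also have "\<dots> \<le> \<epsilon> * n" using n(2) \<open>A \<ge> 0\<close> by (simp add: field_simps)
    finally show ?thesis .
  qed
  with n(1) show ?thesis by blast
qed

lemma finite_return_displacements:
  obtains W V where "finite W" "finite V"
    "\<And>m x. W \<inter> {..x} = W \<inter> {..(f ^^ m) x} \<Longrightarrow> displacement (f ^^ m) x \<in> V"
proof -
  obtain W U where W: "finite W" and U: "finite U"
    and variation: "\<And>n x y. W \<inter> {..x} = W \<inter> {..y} \<Longrightarrow>
      displacement (f ^^ n) y - displacement (f ^^ n) x \<in> U"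
    using finite_displacement_variation[OF piecewise_translation few_breaks] by blast
  obtain H :: "(real \<Rightarrow> real) set" where H: "finite H" "\<And>h. h \<in> H \<Longrightarrow> Modules.additive h"
    and proper: "\<And>r. finite {v \<in> sum_list ` lists T. \<forall>h\<in>H. \<bar>h v\<bar> \<le> r}"
    using finite_proper_additive_functionals[OF finite_steps] by blast
  define r where "r = (\<Sum>(h, u)\<in>H \<times> U. \<bar>h u\<bar>)"
  have r: "\<bar>h u\<bar> \<le> r" if "h \<in> H" "u \<in> U" for h u
    unfolding r_def using that H(1) U member_le_sum[of "(h, u)" "H \<times> U" "\<lambda>(h, u). \<bar>h u\<bar>"] by auto
  let ?V = "{v \<in> sum_list ` lists T. \<forall>h\<in>H. \<bar>h v\<bar> \<le> r}"
  have returns: "displacement (f ^^ m) x \<in> ?V" if cell: "W \<inter> {..x} = W \<inter> {..(f ^^ m) x}" for m x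
  proof -
    have "\<bar>h (displacement (f ^^ m) x)\<bar> \<le> r" if "h \<in> H" for h
    proof (rule abs_displacement_funpow_le_if_sublinear[OF H(2)[OF that]])
      show "\<bar>h (displacement (f ^^ m) ((f ^^ n) x) - displacement (f ^^ m) x)\<bar> \<le> r" for n
        by (subst displacement_funpow_swap) (rule r[OF that variation[OF cell]])
    qed (rule additive_displacement_sublinear[OF H(2)[OF that]])
    moreover have "displacement (f ^^ m) x \<in> sum_list ` lists T"
      using displacement_eq_sum_list[of m x] by auto
    ultimately show ?thesis by blast
  qed
  show ?thesis by (rule that[OF W proper returns])
qed

lemma funpow_eq_id:
  obtains n where "n > 0" "f ^^ n = id"
proof -
  obtain W V where W: "finite W" and V: "finite V" and returns:
      "\<And>m x. W \<inter> {..x} = W \<inter> {..(f ^^ m) x} \<Longrightarrow> displacement (f ^^ m) x \<in> V"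
    by (rule finite_return_displacements) (rule that)
  let ?cell = "\<lambda>x. W \<inter> {..x}"
  let ?L = "card V * card (range ?cell)"
  have "\<not> inj_on (\<lambda>m. (f ^^ m) x) {..?L}" for x
  proof (rule not_inj_on_if_finite_cell_differences[OF V])
    show "finite (range ?cell)" by (rule finite_subset[of _ "Pow W"]) (auto simp: W)
    fix i j :: nat
    assume "i \<le> j"
    then have "(f ^^ j) x = (f ^^ (j - i)) ((f ^^ i) x)" using funpow_add[of "j - i" i f] by simp
    moreover assume "?cell ((f ^^ i) x) = ?cell ((f ^^ j) x)"
    ultimately show "(f ^^ j) x - (f ^^ i) x \<in> V"
      using returns[of "(f ^^ i) x" "j - i"] by (simp add: displacement_def)
  qed
  with bij_is_inj[OF piecewise_translationD(1)[OF piecewise_translation]]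
  have "f ^^ fact ?L = id" by (rule funpow_fact_eq_id_if_bounded_orbits)
  then show ?thesis by (rule that[rotated]) simp
qed

end

theorem theorem1p3:
  shows "\<forall>f \<in> IET. \<not> distortion_in_IET f"
proof (intro ballI notI)
  fix f
  assume "f \<in> IET" and "distortion_in_IET f"
  then obtain S where S: "finite S" "S \<subseteq> IET" and f: "f \<in> gen_subgroup S"
    and order: "infinite_order f"
    and liminf: "liminf (\<lambda>n::nat. ereal (real (word_length S (f ^^ n)) / real n)) = 0"
    by (auto simp: distortion_in_IET_def distortion_fg_def)
  obtain C T where "finite T"
    and "\<And>g. g \<in> gen_subgroup S \<Longrightarrow> card (breaks g) \<le> C * word_length S g"
    and "\<And>g x. g \<in> gen_subgroup S \<Longrightarrow>
      \<exists>xs\<in>lists T. length xs = word_length S g \<and> displacement g x = sum_list xs"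
    by (rule word_length_bounds[OF S]) (rule that)
  then interpret sublinear_piecewise_translation f "\<lambda>n. word_length S (f ^^ n)" C T
    using \<open>f \<in> IET\<close> liminf gen_subgroup_funpow[OF f]
    by unfold_locales (simp_all add: IET_def is_iet_imp_piecewise_translation)
  obtain n where "n > 0" "f ^^ n = id" by (rule funpow_eq_id)
  with order show False by (simp add: infinite_order_def)
qed

end
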